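(* Let $X$ be a fuzzy topological space that is a fuzzy weakly-closed space. Then $\bigwedge_{G\in\Gamma}cl(G)\neq0_X$ for every fuzzy filterbase $\Gamma$ in $X$ consisting of fuzzy weakly-open sets.
   Context: Fuzzy topological spaces (FTS) are in Chang's sense: a fuzzy set in $X$ is a function $X\to[0,1]$, ordered pointwise by $\leq$, with $\vee,\wedge$ pointwise supremum and infimum and complement $A^c=1-A$; $0_X,1_X$ are the constant functions. A fuzzy topology $\tau$ on $X$ is a family of fuzzy sets containing $0_X,1_X$ and closed under finite $\wedge$ and arbitrary $\bigvee$; members of $\tau$ are fuzzy open and their complements fuzzy closed. $cl(A)$ is the infimum of all fuzzy closed sets $\geq A$ and $int(A)$ is the supremum of all fuzzy open sets $\leq A$. A fuzzy set $A$ is fuzzy semi-closed if $int(cl(A))\leq A$; a fuzzy set is fuzzy semi-open if its complement is fuzzy semi-closed. A fuzzy set $A$ is fuzzy weakly-closed if $cl(A)\leq U$ for every fuzzy semi-open set $U$ with $A\leq U$. A fuzzy set is fuzzy weakly-open if its complement is fuzzy weakly-closed. The fuzzy weakly-closure of $A$ is $wcl(A)=\bigwedge\{B\mid B\text{ is fuzzy weakly-closed and }A\leq B\}$. A collection $\Gamma$ of fuzzy sets in $X$ is a fuzzy filterbase if $\bigwedge_{j=1}^nA_j\neq0_X$ for every finite subcollection $\{A_1,\dots,A_n\}$ of $\Gamma$. The space $X$ is a fuzzy weakly-closed space if for every family $\{G_\lambda\mid\lambda\in\Lambda\}$ of fuzzy weakly-open sets with $\left(\bigvee_{\lambda\in\Lambda}G_\lambda\right)(x)=1$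 for every $x\in X$ there is a finite subfamily $G_{\lambda_1},\dots,G_{\lambda_n}$ with $\left(\bigvee_{i=1}^nwcl(G_{\lambda_i})\right)(x)=1$ for every $x\in X$. *)

theory Defs
  imports Complex_Main
begin

text \<open>The unit interval is made a type so that its order is a complete lattice: over the type
  of reals, \<open>Sup {}\<close> and \<open>Inf {}\<close> would not be the values 0 and 1 required here. The function
  space \<open>'a \<Rightarrow> unit_interval\<close> then carries the pointwise order, infima and suprema
  of fuzzy sets.\<close>

typedef unit_interval = "{0..1::real}"
  by (rule exI[of _ 0]) simp

setup_lifting type_definition_unit_interval

instantiation unit_interval :: "{zero_neq_one, linorder}"
begin

lift_definition zero_unit_interval :: unit_interval is "0::real" by simp
lift_definition one_unit_interval :: unit_interval is "1::real" by simp
lift_definition less_eq_unit_interval :: "unit_interval \<Rightarrow> unit_interval \<Rightarrow> bool" is "(\<le>)" .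
lift_definition less_unit_interval :: "unit_interval \<Rightarrow> unit_interval \<Rightarrow> bool" is "(<)" .

instance by standard (transfer; auto)+

end

instantiation unit_interval :: complete_linorder
begin

definition bot_unit_interval :: unit_interval where "bot_unit_interval = 0"
definition top_unit_interval :: unit_interval where "top_unit_interval = 1"
definition inf_unit_interval :: "unit_interval \<Rightarrow> unit_interval \<Rightarrow> unit_interval" where
  "inf_unit_interval = min"
definition sup_unit_interval :: "unit_interval \<Rightarrow> unit_interval \<Rightarrow> unit_interval" where
  "sup_unit_interval = max"

lift_definition Sup_unit_interval :: "unit_interval set \<Rightarrow> unit_interval"
  is "\<lambda>S. if S = {} then 0 else Sup S :: real"
proof -
  fix S :: "real set"
  assume "\<And>t. t \<in> S \<Longrightarrow> t \<in> {0..1}"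
  then have S: "\<And>t. t \<in> S \<Longrightarrow> 0 \<le> t \<and> t \<le> 1"
    by auto
  show "(if S = {} then 0 else Sup S) \<in> {0..1}"
  proof (cases "S = {}")
    case False
    then obtain t where "t \<in> S" by blast
    then have "0 \<le> Sup S" using S by (intro cSup_upper2[of t]) (auto intro!: bdd_aboveI[of _ 1])
    moreover have "Sup S \<le> 1" using S False by (intro cSup_least) auto
    ultimately show ?thesis using False by simp
  qed simp
qed

lift_definition Inf_unit_interval :: "unit_interval set \<Rightarrow> unit_interval"
  is "\<lambda>S. if S = {} then 1 else Inf S :: real"
proof -
  fix S :: "real set"
  assume "\<And>t. t \<in> S \<Longrightarrow> t \<in> {0..1}"
  then have S: "\<And>t. t \<in> S \<Longrightarrow> 0 \<le> t \<and> t \<le> 1"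
    by auto
  show "(if S = {} then 1 else Inf S) \<in> {0..1}"
  proof (cases "S = {}")
    case False
    then obtain t where "t \<in> S" by blast
    then have "Inf S \<le> 1" using S by (intro cInf_lower2[of t]) (auto intro!: bdd_belowI[of _ 0])
    moreover have "0 \<le> Inf S" using S False by (intro cInf_greatest) auto
    ultimately show ?thesis using False by simp
  qed simp
qed

instance
proof
  fix x y z :: unit_interval and S :: "unit_interval set"
  have bounds: "0 \<le> Rep_unit_interval t" "Rep_unit_interval t \<le> 1" for t
    using Rep_unit_interval[of t] by auto
  show "inf x y \<le> x" "inf x y \<le> y" "x \<le> y \<Longrightarrow> x \<le> z \<Longrightarrow> x \<le> inf y z"
    by (auto simp: inf_unit_interval_def)
  show "x \<le> sup x y" "y \<le> sup x y" "y \<le> x \<Longrightarrow> z \<le> x \<Longrightarrow> sup y z \<le> x"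
    by (auto simp: sup_unit_interval_def)
  show "x \<in> S \<Longrightarrow> Inf S \<le> x"
    using bounds
    by (auto simp: less_eq_unit_interval.rep_eq Inf_unit_interval.rep_eq
        intro!: cInf_lower bdd_belowI[of _ 0])
  show "(\<And>t. t \<in> S \<Longrightarrow> z \<le> t) \<Longrightarrow> z \<le> Inf S"
    using bounds
    by (auto simp: less_eq_unit_interval.rep_eq Inf_unit_interval.rep_eq
        intro!: cInf_greatest)
  show "x \<in> S \<Longrightarrow> x \<le> Sup S"
    using bounds
    by (auto simp: less_eq_unit_interval.rep_eq Sup_unit_interval.rep_eq
        intro!: cSup_upper bdd_aboveI[of _ 1])
  show "(\<And>t. t \<in> S \<Longrightarrow> t \<le> z) \<Longrightarrow> Sup S \<le> z"
    using bounds
    by (auto simp: less_eq_unit_interval.rep_eq Sup_unit_interval.rep_eq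
        intro!: cSup_least)
  show "Inf {} = (top :: unit_interval)"
    unfolding top_unit_interval_def by transfer simp
  show "Sup {} = (bot :: unit_interval)"
    unfolding bot_unit_interval_def by transfer simp
qed

end

lift_definition unit_compl :: "unit_interval \<Rightarrow> unit_interval" is "\<lambda>t. 1 - t"
  by simp

lemma unit_interval_bot_top: "(bot :: unit_interval) = 0" "(top :: unit_interval) = 1"
  by (simp_all add: bot_unit_interval_def top_unit_interval_def)

type_synonym 'a fuzzy_set = "'a \<Rightarrow> unit_interval"

definition fuzzy_zero :: "'a fuzzy_set" where
  "fuzzy_zero = (\<lambda>x. 0)"

definition fuzzy_one :: "'a fuzzy_set" where
  "fuzzy_one = (\<lambda>x. 1)"

definition fuzzy_compl :: "'a fuzzy_set \<Rightarrow> 'a fuzzy_set" where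
  "fuzzy_compl A = (\<lambda>x. unit_compl (A x))"

lemma fuzzy_zero_eq_bot: "fuzzy_zero = bot"
  by (simp add: fuzzy_zero_def bot_fun_def unit_interval_bot_top)

lemma fuzzy_one_eq_top: "fuzzy_one = top"
  by (simp add: fuzzy_one_def top_fun_def unit_interval_bot_top)

definition fuzzy_topology :: "'a fuzzy_set set \<Rightarrow> bool" where
  "fuzzy_topology \<tau> \<longleftrightarrow>
     fuzzy_zero \<in> \<tau> \<and> fuzzy_one \<in> \<tau> \<and>
     (\<forall>A\<in>\<tau>. \<forall>B\<in>\<tau>. inf A B \<in> \<tau>) \<and>
     (\<forall>F. F \<subseteq> \<tau> \<longrightarrow> Sup F \<in> \<tau>)"

definition fuzzy_open :: "'a fuzzy_set set \<Rightarrow> 'a fuzzy_set \<Rightarrow> bool" where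
  "fuzzy_open \<tau> A \<longleftrightarrow> A \<in> \<tau>"

definition fuzzy_closed :: "'a fuzzy_set set \<Rightarrow> 'a fuzzy_set \<Rightarrow> bool" where
  "fuzzy_closed \<tau> A \<longleftrightarrow> fuzzy_open \<tau> (fuzzy_compl A)"

definition fuzzy_cl :: "'a fuzzy_set set \<Rightarrow> 'a fuzzy_set \<Rightarrow> 'a fuzzy_set" where
  "fuzzy_cl \<tau> A = Inf {B. fuzzy_closed \<tau> B \<and> A \<le> B}"

definition fuzzy_int :: "'a fuzzy_set set \<Rightarrow> 'a fuzzy_set \<Rightarrow> 'a fuzzy_set" where
  "fuzzy_int \<tau> A = Sup {B. fuzzy_open \<tau> B \<and> B \<le> A}"

definition fuzzy_semi_closed :: "'a fuzzy_set set \<Rightarrow> 'a fuzzy_set \<Rightarrow> bool" where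
  "fuzzy_semi_closed \<tau> A \<longleftrightarrow> fuzzy_int \<tau> (fuzzy_cl \<tau> A) \<le> A"

definition fuzzy_semi_open :: "'a fuzzy_set set \<Rightarrow> 'a fuzzy_set \<Rightarrow> bool" where
  "fuzzy_semi_open \<tau> A \<longleftrightarrow> fuzzy_semi_closed \<tau> (fuzzy_compl A)"

definition fuzzy_weakly_closed :: "'a fuzzy_set set \<Rightarrow> 'a fuzzy_set \<Rightarrow> bool" where
  "fuzzy_weakly_closed \<tau> A \<longleftrightarrow> (\<forall>U. fuzzy_semi_open \<tau> U \<and> A \<le> U \<longrightarrow> fuzzy_cl \<tau> A \<le> U)"

definition fuzzy_weakly_open :: "'a fuzzy_set set \<Rightarrow> 'a fuzzy_set \<Rightarrow> bool" where
  "fuzzy_weakly_open \<tau> A \<longleftrightarrow> fuzzy_weakly_closed \<tau> (fuzzy_compl A)"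

definition fuzzy_wcl :: "'a fuzzy_set set \<Rightarrow> 'a fuzzy_set \<Rightarrow> 'a fuzzy_set" where
  "fuzzy_wcl \<tau> A = Inf {B. fuzzy_weakly_closed \<tau> B \<and> A \<le> B}"

definition fuzzy_filterbase :: "'a fuzzy_set set \<Rightarrow> bool" where
  "fuzzy_filterbase \<Gamma> \<longleftrightarrow> (\<forall>F. finite F \<and> F \<noteq> {} \<and> F \<subseteq> \<Gamma> \<longrightarrow> Inf F \<noteq> fuzzy_zero)"

text \<open>A cover is given as a set of fuzzy sets instead of an indexed family; since suprema do not
  see repetitions, nothing is lost.\<close>

definition fuzzy_weakly_closed_space :: "'a fuzzy_set set \<Rightarrow> bool" where
  "fuzzy_weakly_closed_space \<tau> \<longleftrightarrow>
     (\<forall>\<G>. (\<forall>G\<in>\<G>. fuzzy_weakly_open \<tau> G) \<and> (\<forall>x. (Sup \<G>) x = 1) \<longrightarrow>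
        (\<exists>\<F>. finite \<F> \<and> \<F> \<subseteq> \<G> \<and> (\<forall>x. (SUP G\<in>\<F>. fuzzy_wcl \<tau> G) x = 1)))"

end

(* If the closures had infimum 0, their complements would be a weakly-open cover. Since the
   complement of cl G lies below the weakly-closed set compl G, so does its weakly-closure; a
   finite subcover by weakly-closures therefore forces a finite infimum of members of the
   filterbase to be 0. *)

theory Submission imports Defs begin

lemma unit_compl_involutive [simp]: "unit_compl (unit_compl t) = t"
  by transfer simp

lemma unit_compl_antimono: "s \<le> t \<Longrightarrow> unit_compl t \<le> unit_compl s"
  by transfer simp

lemma unit_compl_0 [simp]: "unit_compl 0 = 1"
  by transfer simp

lemma unit_compl_1 [simp]: "unit_compl 1 = 0"
  by transfer simp

lemma fuzzy_compl_involutive [simp]: "fuzzy_compl (fuzzy_compl A) = A"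
  by (simp add: fuzzy_compl_def)

lemma fuzzy_compl_antimono: "A \<le> B \<Longrightarrow> fuzzy_compl B \<le> fuzzy_compl A"
  by (simp add: fuzzy_compl_def le_fun_def unit_compl_antimono)

text \<open>Complementation is an order-reversing involution, so it forms an antitone Galois
  connection with itself. Rewriting with this form moves a complement across
  \<open>\<le>\<close>.\<close>

lemma fuzzy_compl_le_iff: "fuzzy_compl A \<le> B \<longleftrightarrow> fuzzy_compl B \<le> A"
  using fuzzy_compl_antimono[of "fuzzy_compl A" B] fuzzy_compl_antimono[of "fuzzy_compl B" A]
  by auto

text \<open>De Morgan's law, obtained from the order alone; it covers \<open>S = {}\<close> as
  well.\<close>

lemma fuzzy_compl_Inf: "fuzzy_compl (Inf S) = (SUP A\<in>S. fuzzy_compl A)"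
proof (rule antisym)
  show "fuzzy_compl (Inf S) \<le> (SUP A\<in>S. fuzzy_compl A)"
    by (subst fuzzy_compl_le_iff, rule Inf_greatest, subst fuzzy_compl_le_iff, rule SUP_upper)
  show "(SUP A\<in>S. fuzzy_compl A) \<le> fuzzy_compl (Inf S)"
    by (intro SUP_least fuzzy_compl_antimono Inf_lower)
qed

lemma fuzzy_compl_zero [simp]: "fuzzy_compl fuzzy_zero = fuzzy_one"
  by (simp add: fuzzy_compl_def fuzzy_zero_def fuzzy_one_def)

lemma fuzzy_compl_one [simp]: "fuzzy_compl fuzzy_one = fuzzy_zero"
  by (simp add: fuzzy_compl_def fuzzy_zero_def fuzzy_one_def)

lemma fuzzy_cl_upper: "A \<le> fuzzy_cl \<tau> A"
  unfolding fuzzy_cl_def by (rule Inf_greatest) simp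

lemma fuzzy_cl_lower: "fuzzy_closed \<tau> B \<Longrightarrow> A \<le> B \<Longrightarrow> fuzzy_cl \<tau> A \<le> B"
  unfolding fuzzy_cl_def by (rule Inf_lower) simp

text \<open>By De Morgan, the complement of the closure is a supremum of open sets, hence
  open.\<close>

lemma fuzzy_closed_cl:
  assumes "fuzzy_topology \<tau>"
  shows "fuzzy_closed \<tau> (fuzzy_cl \<tau> A)"
proof -
  have "fuzzy_compl ` {B. fuzzy_closed \<tau> B \<and> A \<le> B} \<subseteq> \<tau>"
    by (auto simp: fuzzy_closed_def fuzzy_open_def)
  then show ?thesis
    using assms
    unfolding fuzzy_closed_def fuzzy_open_def fuzzy_cl_def fuzzy_compl_Inf fuzzy_topology_def
    by blast
qed

text \<open>The closure of a closed \<open>A\<close> lies below \<open>A\<close>, hence below every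
  \<open>U\<close> above \<open>A\<close>, semi-open or not.\<close>

lemma fuzzy_closed_imp_weakly_closed: "fuzzy_closed \<tau> A \<Longrightarrow> fuzzy_weakly_closed \<tau> A"
  unfolding fuzzy_weakly_closed_def using fuzzy_cl_lower[of \<tau> A A] by (meson order.refl order.trans)

lemma fuzzy_wcl_lower: "fuzzy_weakly_closed \<tau> B \<Longrightarrow> A \<le> B \<Longrightarrow> fuzzy_wcl \<tau> A \<le> B"
  unfolding fuzzy_wcl_def by (rule Inf_lower) simp

theorem theorem4p14:
  fixes \<tau> :: "'a fuzzy_set set" and \<Gamma> :: "'a fuzzy_set set"
  assumes "fuzzy_topology \<tau>"
    and "fuzzy_weakly_closed_space \<tau>"
    and "fuzzy_filterbase \<Gamma>"
    and "\<And>G. G \<in> \<Gamma> \<Longrightarrow> fuzzy_weakly_open \<tau> G"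
  shows "(INF G\<in>\<Gamma>. fuzzy_cl \<tau> G) \<noteq> fuzzy_zero"
proof
  assume zero: "(INF G\<in>\<Gamma>. fuzzy_cl \<tau> G) = fuzzy_zero"
  define H where "H G = fuzzy_compl (fuzzy_cl \<tau> G)" for G
  have "Sup (H ` \<Gamma>) = fuzzy_one"
    using fuzzy_compl_Inf[of "fuzzy_cl \<tau> ` \<Gamma>"] zero by (simp add: image_image H_def)
  then have "\<forall>x. (Sup (H ` \<Gamma>)) x = 1"
    by (simp add: fuzzy_one_def)
  \<comment> \<open>The complement of \<open>H G\<close> is \<open>fuzzy_cl \<tau> G\<close> again,
    which is closed and therefore weakly closed.\<close>
  moreover have "\<forall>G\<in>H ` \<Gamma>. fuzzy_weakly_open \<tau> G"
    using fuzzy_closed_imp_weakly_closed[OF fuzzy_closed_cl[OF assms(1)]]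
    by (auto simp: H_def fuzzy_weakly_open_def)
  ultimately have "\<exists>\<F>. finite \<F> \<and> \<F> \<subseteq> H ` \<Gamma> \<and> (\<forall>x. (SUP G\<in>\<F>. fuzzy_wcl \<tau> G) x = 1)"
    using assms(2)[unfolded fuzzy_weakly_closed_space_def, rule_format, of "H ` \<Gamma>"] by simp
  then obtain \<F> where "finite \<F>" "\<F> \<subseteq> H ` \<Gamma>"
    and cover: "\<forall>x. (SUP G\<in>\<F>. fuzzy_wcl \<tau> G) x = 1"
    by (elim exE conjE)
  \<comment> \<open>The filterbase condition speaks of members of \<open>\<Gamma>\<close>, so the
    finite subcover is pulled back along \<open>H\<close>, which need not be injective; finitely
    many preimages suffice.\<close>
  then obtain F where F: "F \<subseteq> \<Gamma>" "finite F" "\<F> = H ` F"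
    by (meson finite_subset_image)
  have "fuzzy_wcl \<tau> (H G) \<le> fuzzy_compl G" if "G \<in> F" for G
    unfolding H_def using assms(4) that F(1)
    by (intro fuzzy_wcl_lower fuzzy_compl_antimono fuzzy_cl_upper)
      (auto simp: fuzzy_weakly_open_def)
  then have "(SUP G\<in>\<F>. fuzzy_wcl \<tau> G) \<le> fuzzy_compl (Inf F)"
    unfolding fuzzy_compl_Inf F(3) image_image by (intro SUP_mono) blast
  moreover have "(SUP G\<in>\<F>. fuzzy_wcl \<tau> G) = fuzzy_one"
    unfolding fuzzy_one_def using cover by (intro ext) (rule spec)
  \<comment> \<open>By De Morgan, this complement lies above the finite supremum, which is already
    the top element.\<close>
  ultimately have "fuzzy_compl (Inf F) = fuzzy_one"
    by (simp add: fuzzy_one_eq_top top_unique)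
  then have "Inf F = fuzzy_zero"
    by (metis fuzzy_compl_involutive fuzzy_compl_one)
  \<comment> \<open>The filterbase condition concerns nonempty finite subfamilies only. The empty
    infimum is constantly 1, and types are inhabited, so it differs from
    \<open>fuzzy_zero\<close>.\<close>
  moreover from this have "F \<noteq> {}"
    by (auto simp: fun_eq_iff fuzzy_zero_def unit_interval_bot_top)
  ultimately show False
    using assms(3) F unfolding fuzzy_filterbase_def by blast
qed

end
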